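(* The functors $\lambda\colon\omega\text{-}\mathbf{cat}\to\mathbf{ADC}$ and $\nu\colon\mathbf{ADC}\to\omega\text{-}\mathbf{cat}$ form an adjoint pair ($\lambda$ left adjoint to $\nu$) with unit $\eta\colon\mathrm{id}\to\nu\lambda$ and counit $\pi\colon\lambda\nu\to\mathrm{id}$.
   Context: Signs $\alpha,\beta$ range over $\{-,+\}$; $m,n$ are nonnegative integers. $\omega$-categories. An $\omega$-category is a set with unary operators $d^-_n,d^+_n$ and partially defined binary composition operators $(x,y)\mapsto x\#_n y$ ($n\ge 0$) such that: (i) $x\#_n y$ is defined iff $d^+_n x=d^-_n y$; (ii) for every $x$ there is $n$ with $d^-_n x=d^+_n x=x$; (iii) $d^\beta_m d^\alpha_n x=d^\beta_m x$ if $m<n$, and $=d^\alpha_n x$ if $m\ge n$; (iv) $d^-_n x\#_n x=x\#_n d^+_n x=x$; (v) if $x\#_n y$ is defined then $d^\alpha_m(x\#_n y)=d^\alpha_m x=d^\alpha_m y=d^\alpha_m x\#_n d^\alpha_m y$ for $m<n$, $d^-_n(x\#_n y)=d^-_n x$, $d^+_n(x\#_n y)=d^+_n y$, and $d^\alpha_m(x\#_n y)=d^\alpha_m x\#_n d^\alpha_m y$ for $m>n$; (vi) $(x\#_n y)\#_n z=x\#_n(y\#_n z)$ if either side is defined; (vii) if $m<n$ then $(x\#_n y)\#_m(x'\#_n y')=(x\#_m x')\#_n(y\#_m y')$ when the left side is defined. A morphism is a function commuting with all these operators; the category is $\omega\text{-}\mathbf{cat}$. For an $\omega$-category $C$, $C_n=\{x\in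 C: d^-_n x=x\}=\{x\in C:d^+_n x=x\}$, a sub-$\omega$-category. Augmented directed complexes. An augmented directed complex $K$ is an augmented chain complex $(K_n,\partial,\epsilon)$ of abelian groups concentrated in nonnegative dimensions (with $\epsilon\colon K_0\to\mathbf{Z}$, $\epsilon\partial=0$) together with a submonoid $K^*_n\subset K_n$ for each $n$ (a subset containing $0$ and closed under addition). A morphism $K\to L$ is an augmentation-preserving chain map $f$ with $f(K^*_n)\subset L^*_n$ for all $n$. The category is $\mathbf{ADC}$. The functor $\lambda$. For an $\omega$-category $C$, $(\lambda C)_n$ is the abelian group generated by elements $[x]_n$ for $x\in C_n$ subject to relations $[x\#_m y]_n=[x]_n+[y]_n$ for $m<n$; $\partial[x]_{n+1}=[d^+_n x]_n-[d^-_n x]_n$; $\epsilon[x]_0=1$; and $(\lambda C)^*_n$ is the submonoid generated by the elements $[x]_n$. The functor $\nu$. For a chain complex $K$ of abelian groups, $\mu K$ is the abelian group of double sequences $x=(x^-_0,x^+_0,x^-_1,x^+_1,\ldots)$ with $x^\alpha_n\in K_n$, $x^-_n=x^+_n=0$ for all but finitely many $n$, and $x^+_n-x^-_n=\partial x^-_{n+1}=\partial x^+_{n+1}$ for $n\ge0$; it is an $\omega$-category with $d^\alpha_n x=(x^-_0,x^+_0,\ldots,x^-_{n-1},x^+_{n-1},x^\alpha_n,x^\alpha_n,0,0,\ldots)$ and, if $d^+_n x=d^-_n y=z$, $x\#_n y=x-z+y$. For an augmented directed complex $K$, $\nu K$ is the sub-$\omega$-category of $\mu K$ consisting of the $x$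 with $x^-_n,x^+_n\in K^*_n$ for all $n$ and $\epsilon x^-_0=\epsilon x^+_0=1$. Unit and counit. For an $\omega$-category $C$, $\eta\colon C\to\nu\lambda C$ is $\eta x=([d^-_0 x]_0,[d^+_0 x]_0,[d^-_1 x]_1,[d^+_1 x]_1,\ldots)$. For an augmented directed complex $K$, $\pi\colon\lambda\nu K\to K$ is given by $\pi[x]_n=x^-_n=x^+_n$ for $x\in(\nu K)_n$. *)

theory Defs
  imports "HOL-Algebra.Free_Abelian_Groups" "HOL.Hull"
begin

datatype sign = Minus | Plus

record 'a omega_cat = "'a partial_object" +
  dd :: "sign \<Rightarrow> nat \<Rightarrow> 'a \<Rightarrow> 'a"
  cmp :: "nat \<Rightarrow> 'a \<Rightarrow> 'a \<Rightarrow> 'a"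

text \<open>The composite \<open>x #\<^sub>n y\<close> is \<open>cmp C n x y\<close>. It counts as defined exactly when
  \<open>composable C n x y\<close> holds; for all other arguments the value of \<open>cmp\<close> is irrelevant and
  is never used.\<close>

definition composable :: "('a, 'm) omega_cat_scheme \<Rightarrow> nat \<Rightarrow> 'a \<Rightarrow> 'a \<Rightarrow> bool" where
  "composable C n x y \<longleftrightarrow>
     x \<in> carrier C \<and> y \<in> carrier C \<and> dd C Plus n x = dd C Minus n y"

text \<open>Each composite that occurs on the right-hand side of one of the equations below is
  automatically defined, by the remaining axioms, whenever the stated premises hold; in
  \<open>assoc\<close> the two alternatives of the premise are equivalent by \<open>d_cmp_eq\<close>.\<close>

locale omega_category =
  fixes C :: "('a, 'm) omega_cat_scheme"
  assumes d_closed: "x \<in> carrier C \<Longrightarrow> dd C \<alpha> n x \<in> carrier C"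
    and cmp_closed: "composable C n x y \<Longrightarrow> cmp C n x y \<in> carrier C"
    and d_stable: "x \<in> carrier C \<Longrightarrow> \<exists>n. dd C Minus n x = x \<and> dd C Plus n x = x"
    and d_d: "x \<in> carrier C \<Longrightarrow>
      dd C \<beta> m (dd C \<alpha> n x) = (if m < n then dd C \<beta> m x else dd C \<alpha> n x)"
    and cmp_unit_left: "x \<in> carrier C \<Longrightarrow> cmp C n (dd C Minus n x) x = x"
    and cmp_unit_right: "x \<in> carrier C \<Longrightarrow> cmp C n x (dd C Plus n x) = x"
    and d_cmp_less: "\<lbrakk>composable C n x y; m < n\<rbrakk> \<Longrightarrow>
      dd C \<alpha> m (cmp C n x y) = dd C \<alpha> m x \<and> dd C \<alpha> m x = dd C \<alpha> m y \<and>
      dd C \<alpha> m y = cmp C n (dd C \<alpha> m x) (dd C \<alpha> m y)"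
    and d_cmp_eq: "composable C n x y \<Longrightarrow>
      dd C Minus n (cmp C n x y) = dd C Minus n x \<and> dd C Plus n (cmp C n x y) = dd C Plus n y"
    and d_cmp_greater: "\<lbrakk>composable C n x y; n < m\<rbrakk> \<Longrightarrow>
      dd C \<alpha> m (cmp C n x y) = cmp C n (dd C \<alpha> m x) (dd C \<alpha> m y)"
    and assoc:
      "(composable C n x y \<and> composable C n (cmp C n x y) z) \<or>
       (composable C n y z \<and> composable C n x (cmp C n y z)) \<Longrightarrow>
       cmp C n (cmp C n x y) z = cmp C n x (cmp C n y z)"
    and interchange:
      "\<lbrakk>m < n; composable C n x y; composable C n x' y';
        composable C m (cmp C n x y) (cmp C n x' y')\<rbrakk> \<Longrightarrow>
       cmp C m (cmp C n x y) (cmp C n x' y') = cmp C n (cmp C m x x') (cmp C m y y')"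

text \<open>Morphisms are extensional functions on the carrier, so that equality of morphisms is
  equality in HOL; identities are \<open>restrict id\<close> and composition is \<open>compose\<close>.\<close>

definition omega_hom :: "('a, 'm) omega_cat_scheme \<Rightarrow> ('b, 'k) omega_cat_scheme \<Rightarrow> ('a \<Rightarrow> 'b) set" where
  "omega_hom C D = {f \<in> carrier C \<rightarrow>\<^sub>E carrier D.
     (\<forall>\<alpha> n. \<forall>x \<in> carrier C. f (dd C \<alpha> n x) = dd D \<alpha> n (f x)) \<and>
     (\<forall>n x y. composable C n x y \<longrightarrow> f (cmp C n x y) = cmp D n (f x) (f y))}"

definition omega_id :: "('a, 'm) omega_cat_scheme \<Rightarrow> 'a \<Rightarrow> 'a" where
  "omega_id C = (\<lambda>x \<in> carrier C. x)"

definition omega_comp ::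
  "('a, 'm) omega_cat_scheme \<Rightarrow> ('b \<Rightarrow> 'c) \<Rightarrow> ('a \<Rightarrow> 'b) \<Rightarrow> 'a \<Rightarrow> 'c" where
  "omega_comp C g f = compose (carrier C) g f"

definition cells :: "('a, 'm) omega_cat_scheme \<Rightarrow> nat \<Rightarrow> 'a set" where
  "cells C n = {x \<in> carrier C. dd C Minus n x = x}"

text \<open>The abelian groups of a complex are written multiplicatively, as is customary in
  HOL-Algebra. The boundary \<open>bd K n\<close> goes from degree \<open>n + 1\<close> to degree \<open>n\<close>.\<close>

record 'a cplx =
  grp :: "nat \<Rightarrow> 'a monoid"
  bd :: "nat \<Rightarrow> 'a \<Rightarrow> 'a"

record 'a adc = "'a cplx" +
  aug :: "'a \<Rightarrow> int"
  pos :: "nat \<Rightarrow> 'a set"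

locale chain_cplx =
  fixes K :: "('a, 'm) cplx_scheme"
  assumes grp_comm: "comm_group (grp K n)"
    and bd_hom: "bd K n \<in> hom (grp K (Suc n)) (grp K n)"
    and bd_bd: "x \<in> carrier (grp K (Suc (Suc n))) \<Longrightarrow> bd K n (bd K (Suc n) x) = \<one>\<^bsub>grp K n\<^esub>"

locale aug_dir_cplx = chain_cplx K
  for K :: "('a, 'm) adc_scheme" (structure) +
  assumes aug_hom: "aug K \<in> hom (grp K 0) integer_group"
    and aug_bd: "x \<in> carrier (grp K 1) \<Longrightarrow> aug K (bd K 0 x) = 0"
    and pos_submonoid: "submonoid (pos K n) (grp K n)"

definition adc_hom :: "('a, 'm) adc_scheme \<Rightarrow> ('b, 'k) adc_scheme \<Rightarrow> (nat \<Rightarrow> 'a \<Rightarrow> 'b) set" where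
  "adc_hom K L = {f.
     (\<forall>n. f n \<in> hom (grp K n) (grp L n) \<inter> extensional (carrier (grp K n))) \<and>
     (\<forall>n. \<forall>x \<in> carrier (grp K (Suc n)). bd L n (f (Suc n) x) = f n (bd K n x)) \<and>
     (\<forall>x \<in> carrier (grp K 0). aug L (f 0 x) = aug K x) \<and>
     (\<forall>n. f n ` pos K n \<subseteq> pos L n)}"

definition adc_id :: "('a, 'm) adc_scheme \<Rightarrow> nat \<Rightarrow> 'a \<Rightarrow> 'a" where
  "adc_id K = (\<lambda>n. \<lambda>x \<in> carrier (grp K n). x)"

definition adc_comp ::
  "('a, 'm) adc_scheme \<Rightarrow> (nat \<Rightarrow> 'b \<Rightarrow> 'c) \<Rightarrow> (nat \<Rightarrow> 'a \<Rightarrow> 'b) \<Rightarrow> nat \<Rightarrow> 'a \<Rightarrow> 'c" where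
  "adc_comp K g f = (\<lambda>n. compose (carrier (grp K n)) (g n) (f n))"

definition lam_rels :: "('a, 'm) omega_cat_scheme \<Rightarrow> nat \<Rightarrow> ('a \<Rightarrow>\<^sub>0 int) set" where
  "lam_rels C n = {frag_of (cmp C m x y) - (frag_of x + frag_of y) | m x y.
     m < n \<and> x \<in> cells C n \<and> y \<in> cells C n \<and> composable C m x y}"

definition lam_sub :: "('a, 'm) omega_cat_scheme \<Rightarrow> nat \<Rightarrow> ('a \<Rightarrow>\<^sub>0 int) set" where
  "lam_sub C n = generate (free_Abelian_group (cells C n)) (lam_rels C n)"

definition lam_grp :: "('a, 'm) omega_cat_scheme \<Rightarrow> nat \<Rightarrow> ('a \<Rightarrow>\<^sub>0 int) set monoid" where
  "lam_grp C n = free_Abelian_group (cells C n) Mod lam_sub C n"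

definition gen :: "('a, 'm) omega_cat_scheme \<Rightarrow> nat \<Rightarrow> 'a \<Rightarrow> ('a \<Rightarrow>\<^sub>0 int) set" where
  "gen C n x = lam_sub C n #>\<^bsub>free_Abelian_group (cells C n)\<^esub> frag_of x"

text \<open>The homomorphism from \<open>lam_grp C n\<close> to \<open>G\<close> that is given on generators by
  \<open>gen C n x \<mapsto> \<phi> x\<close>. By \<open>lam_lift_unique\<close> below it exists and is unique whenever
  \<open>\<phi>\<close> respects the relations.\<close>

definition lam_lift ::
  "('a, 'm) omega_cat_scheme \<Rightarrow> nat \<Rightarrow> 'b monoid \<Rightarrow> ('a \<Rightarrow> 'b) \<Rightarrow> ('a \<Rightarrow>\<^sub>0 int) set \<Rightarrow> 'b" where
  "lam_lift C n G \<phi> = (THE h. h \<in> hom (lam_grp C n) G \<inter> extensional (carrier (lam_grp C n)) \<and>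
     (\<forall>x \<in> cells C n. h (gen C n x) = \<phi> x))"

lemma lam_lift_unique:
  assumes G: "comm_group G" and \<phi>: "\<phi> \<in> cells C n \<rightarrow> carrier G"
    and rel: "\<And>m x y. \<lbrakk>m < n; x \<in> cells C n; y \<in> cells C n; composable C m x y\<rbrakk> \<Longrightarrow>
      cmp C m x y \<in> cells C n \<and> \<phi> (cmp C m x y) = \<phi> x \<otimes>\<^bsub>G\<^esub> \<phi> y"
  shows "\<exists>!h. h \<in> hom (lam_grp C n) G \<inter> extensional (carrier (lam_grp C n)) \<and>
     (\<forall>x \<in> cells C n. h (gen C n x) = \<phi> x)"
proof -
  interpret G: comm_group G by (fact G)
  let ?F = "free_Abelian_group (cells C n)" and ?N = "lam_sub C n"
  interpret F: comm_group ?F by (rule abelian_free_Abelian_group)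
  have rels: "lam_rels C n \<subseteq> carrier ?F"
  proof
    fix c assume "c \<in> lam_rels C n"
    then obtain m x y where c: "c = frag_of (cmp C m x y) - (frag_of x + frag_of y)"
      and *: "m < n" "x \<in> cells C n" "y \<in> cells C n" "composable C m x y"
      by (auto simp: lam_rels_def)
    have "frag_of (cmp C m x y) \<in> carrier ?F" "frag_of x + frag_of y \<in> carrier ?F"
      using rel[OF *] * F.m_closed[of "frag_of x" "frag_of y"] by auto
    then show "c \<in> carrier ?F"
      using keys_diff[of "frag_of (cmp C m x y)" "frag_of x + frag_of y"] unfolding c by auto
  qed
  have N: "subgroup ?N ?F"
    unfolding lam_sub_def by (rule F.generate_is_subgroup[OF rels])
  then have nN: "?N \<lhd> ?F"
    by (rule F.subgroup_imp_normal)
  obtain h where h: "h \<in> hom ?F G" "\<And>x. x \<in> cells C n \<Longrightarrow> h (frag_of x) = \<phi> x"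
    using G.free_Abelian_group_universal[of \<phi> "cells C n"] \<phi> by blast
  interpret h: group_hom ?F G h
    using h(1) by unfold_locales
  have hdiff: "h (a - b) = h a \<otimes>\<^bsub>G\<^esub> inv\<^bsub>G\<^esub> h b" if "a \<in> carrier ?F" "b \<in> carrier ?F" for a b
    using h.hom_mult[of a "-b"] h.hom_inv[of b] that by simp
  have "lam_rels C n \<subseteq> kernel ?F G h"
  proof
    fix c assume cc: "c \<in> lam_rels C n"
    then obtain m x y where c: "c = frag_of (cmp C m x y) - (frag_of x + frag_of y)"
      and *: "m < n" "x \<in> cells C n" "y \<in> cells C n" "composable C m x y"
      by (auto simp: lam_rels_def)
    have xy: "frag_of x + frag_of y \<in> carrier ?F" "h (frag_of x + frag_of y) = \<phi> x \<otimes>\<^bsub>G\<^esub> \<phi> y"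
      using F.m_closed[of "frag_of x" "frag_of y"] h.hom_mult[of "frag_of x" "frag_of y"] h(2) *
      by auto
    have "h c = \<one>\<^bsub>G\<^esub>"
      unfolding c using hdiff[of "frag_of (cmp C m x y)" "frag_of x + frag_of y"] xy rel[OF *] h(2) \<phi> *
      by (auto simp: Pi_iff G.r_inv)
    then show "c \<in> kernel ?F G h"
      using subsetD[OF rels cc] by (simp add: kernel_def)
  qed
  then have ker: "?N \<subseteq> kernel ?F G h"
    unfolding lam_sub_def by (rule F.generate_subgroup_incl[OF _ h.subgroup_kernel])
  have wd: "h x = h y"
    if xy: "x \<in> carrier ?F" "y \<in> carrier ?F" "?N #>\<^bsub>?F\<^esub> x = ?N #>\<^bsub>?F\<^esub> y" for x y
  proof -
    from xy have "x \<in> ?N #>\<^bsub>?F\<^esub> y"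
      using F.rcos_self[OF xy(1) N] by simp
    then obtain z where z: "z \<in> ?N" "x = z + y"
      by (auto simp: r_coset_def)
    then have "z \<in> carrier ?F" "h z = \<one>\<^bsub>G\<^esub>"
      using ker by (auto simp: kernel_def)
    then show "h x = h y"
      using z xy(2) h.hom_mult[of z y] h.hom_closed[of y] by simp
  qed
  obtain g where g: "g \<in> hom (?F Mod ?N) G" "\<And>x. x \<in> carrier ?F \<Longrightarrow> g (?N #>\<^bsub>?F\<^esub> x) = h x"
    using FactGroup_universal[OF h(1) nN wd] by metis
  show ?thesis
  proof (rule ex1I)
    have 1: "restrict g (carrier (lam_grp C n)) \<in> hom (lam_grp C n) G"
      using g(1) group.is_monoid[OF normal.factorgroup_is_group[OF nN]]
      by (auto simp: hom_def lam_grp_def Pi_iff dest: monoid.m_closed)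
    have 2: "gen C n x \<in> carrier (lam_grp C n)" "g (gen C n x) = \<phi> x" if "x \<in> cells C n" for x
      using that g(2)[of "frag_of x"] h(2)[of x]
      by (auto simp: gen_def lam_grp_def carrier_FactGroup)
    show "restrict g (carrier (lam_grp C n)) \<in>
        hom (lam_grp C n) G \<inter> extensional (carrier (lam_grp C n)) \<and>
        (\<forall>x\<in>cells C n. restrict g (carrier (lam_grp C n)) (gen C n x) = \<phi> x)"
      using 1 2 by auto
  next
    fix k assume k: "k \<in> hom (lam_grp C n) G \<inter> extensional (carrier (lam_grp C n)) \<and>
        (\<forall>x\<in>cells C n. k (gen C n x) = \<phi> x)"
    let ?k = "\<lambda>c. k (?N #>\<^bsub>?F\<^esub> c)"
    have kh: "?k \<in> hom ?F G"
      using hom_compose[OF normal.r_coset_hom_Mod[OF nN], of k G] k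
      by (simp add: lam_grp_def comp_def)
    interpret k: group_hom ?F G ?k
      using kh by unfold_locales
    have "?k c = h c" if "Poly_Mapping.keys c \<subseteq> cells C n" for c
      using that
    proof (rule free_Abelian_group_induct)
      show "?k 0 = h 0"
        using k.hom_one h.hom_one by simp
      show "?k (a - b) = h (a - b)"
        if "Poly_Mapping.keys a \<subseteq> cells C n" "Poly_Mapping.keys b \<subseteq> cells C n"
          "?k a = h a" "?k b = h b" for a b
        using that k.hom_mult[of a "-b"] k.hom_inv[of b] hdiff[of a b] by simp
      show "?k (frag_of a) = h (frag_of a)" if "a \<in> cells C n" for a
        using that k h(2) by (simp add: gen_def)
    qed
    then have "k X = g X" if "X \<in> carrier (lam_grp C n)" for X
      using that g(2) by (auto simp: lam_grp_def carrier_FactGroup)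
    then show "k = restrict g (carrier (lam_grp C n))"
      using k by (auto intro!: extensionalityI[of _ "carrier (lam_grp C n)"])
  qed
qed

definition lam :: "('a, 'm) omega_cat_scheme \<Rightarrow> ('a \<Rightarrow>\<^sub>0 int) set adc" where
  "lam C = \<lparr> grp = lam_grp C,
     bd = (\<lambda>n. lam_lift C (Suc n) (lam_grp C n)
       (\<lambda>x. gen C n (dd C Plus n x) \<otimes>\<^bsub>lam_grp C n\<^esub> inv\<^bsub>lam_grp C n\<^esub> gen C n (dd C Minus n x))),
     aug = lam_lift C 0 integer_group (\<lambda>x. 1),
     pos = (\<lambda>n. (\<lambda>H. submonoid H (lam_grp C n)) hull (gen C n ` cells C n)) \<rparr>"

definition lam_map ::
  "('a, 'm) omega_cat_scheme \<Rightarrow> ('b, 'k) omega_cat_scheme \<Rightarrow> ('a \<Rightarrow> 'b) \<Rightarrow>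
   nat \<Rightarrow> ('a \<Rightarrow>\<^sub>0 int) set \<Rightarrow> ('b \<Rightarrow>\<^sub>0 int) set" where
  "lam_map C D f = (\<lambda>n. lam_lift C n (lam_grp D n) (\<lambda>x. gen D n (f x)))"

text \<open>In a double sequence \<open>x\<close>, the entry in degree \<open>n\<close> with sign \<open>\<alpha>\<close> is \<open>x n \<alpha>\<close>.\<close>

definition mu_d :: "('a, 'm) cplx_scheme \<Rightarrow> sign \<Rightarrow> nat \<Rightarrow> (nat \<Rightarrow> sign \<Rightarrow> 'a) \<Rightarrow> nat \<Rightarrow> sign \<Rightarrow> 'a" where
  "mu_d K \<alpha> n x = (\<lambda>k \<beta>. if k < n then x k \<beta> else if k = n then x n \<alpha> else \<one>\<^bsub>grp K k\<^esub>)"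

definition mu :: "('a, 'm) cplx_scheme \<Rightarrow> (nat \<Rightarrow> sign \<Rightarrow> 'a) omega_cat" where
  "mu K = \<lparr> carrier = {x.
       (\<forall>n \<alpha>. x n \<alpha> \<in> carrier (grp K n)) \<and>
       finite {n. \<exists>\<alpha>. x n \<alpha> \<noteq> \<one>\<^bsub>grp K n\<^esub>} \<and>
       (\<forall>n \<alpha>. x n Plus \<otimes>\<^bsub>grp K n\<^esub> inv\<^bsub>grp K n\<^esub> x n Minus = bd K n (x (Suc n) \<alpha>))},
     dd = mu_d K,
     cmp = (\<lambda>n x y k \<beta>.
       x k \<beta> \<otimes>\<^bsub>grp K k\<^esub> inv\<^bsub>grp K k\<^esub> (mu_d K Plus n x k \<beta>) \<otimes>\<^bsub>grp K k\<^esub> y k \<beta>) \<rparr>"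

definition nu :: "('a, 'm) adc_scheme \<Rightarrow> (nat \<Rightarrow> sign \<Rightarrow> 'a) omega_cat" where
  "nu K = (mu K) \<lparr> carrier :=
     {x \<in> carrier (mu K). (\<forall>n \<alpha>. x n \<alpha> \<in> pos K n) \<and> (\<forall>\<alpha>. aug K (x 0 \<alpha>) = 1)} \<rparr>"

definition nu_map ::
  "('a, 'm) adc_scheme \<Rightarrow> (nat \<Rightarrow> 'a \<Rightarrow> 'b) \<Rightarrow> (nat \<Rightarrow> sign \<Rightarrow> 'a) \<Rightarrow> nat \<Rightarrow> sign \<Rightarrow> 'b" where
  "nu_map K f = (\<lambda>x \<in> carrier (nu K). \<lambda>n \<alpha>. f n (x n \<alpha>))"

definition eta :: "('a, 'm) omega_cat_scheme \<Rightarrow> 'a \<Rightarrow> nat \<Rightarrow> sign \<Rightarrow> ('a \<Rightarrow>\<^sub>0 int) set" where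
  "eta C = (\<lambda>x \<in> carrier C. \<lambda>n \<alpha>. gen C n (dd C \<alpha> n x))"

text \<open>For \<open>x \<in> cells (nu K) n\<close> one has \<open>x n Minus = x n Plus\<close>.\<close>

definition counit ::
  "('a, 'm) adc_scheme \<Rightarrow> nat \<Rightarrow> ((nat \<Rightarrow> sign \<Rightarrow> 'a) \<Rightarrow>\<^sub>0 int) set \<Rightarrow> 'a" where
  "counit K = (\<lambda>n. lam_lift (nu K) n (grp K n) (\<lambda>x. x n Minus))"

end

theory Submission
  imports Defs
begin

text \<open>Every identity between homomorphisms out of \<open>lam C\<close> can be checked on the generators
  \<open>[x]\<^sub>n\<close>, and every identity in \<open>nu K\<close> can be checked entry by entry. For the latter,
  \<open>x #\<^sub>n y\<close> agrees with \<open>x\<close> and \<open>y\<close> below degree \<open>n\<close>, has the entries \<open>x\<^sub>n\<^sup>-\<close> and \<open>y\<^sub>n\<^sup>+\<close> in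
  degree \<open>n\<close>, and is the product of \<open>x\<close> and \<open>y\<close> above degree \<open>n\<close>, which makes the axioms of
  an \<open>\<omega>\<close>-category evident.\<close>

section \<open>The complex of an omega-category\<close>

text \<open>The relations of \<open>lam_grp C n\<close> concern composites over m < n, and these are
  the degrees n in which a composite in \<open>nu K\<close> is the product of its factors. This
  match makes \<open>counit\<close> respect the relations and \<open>eta\<close> respect composites.
  Two points need more. A member of \<open>nu\<close> has finite support, while
  \<open>eta C x\<close> has an entry in every degree; the relations force the high ones to vanish,
  since they kill classes of lower-dimensional cells (\<open>gen_degenerate\<close>). And the
  boundary into degree n must also be additive on composites over n itself, where the factors share
  a face; there the shared face cancels (\<open>mult_inv_telescope\<close>).\<close>

lemma not_Minus_iff: "\<alpha> \<noteq> Minus \<longleftrightarrow> \<alpha> = Plus"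
  by (cases \<alpha>) auto

text \<open>Serves composites over degree n: with \<open>b\<close> the face shared by two factors,
  \<open>c\<close> the source of the first and \<open>a\<close> the target of the second, the
  boundaries of the factors add up to that of the composite.\<close>

lemma (in comm_group) mult_inv_telescope:
  assumes "a \<in> carrier G" "b \<in> carrier G" "c \<in> carrier G"
  shows "a \<otimes> inv c = (b \<otimes> inv c) \<otimes> (a \<otimes> inv b)"
proof -
  \<comment> \<open>With \<open>inv b\<close> and \<open>inv c\<close> generalised to arbitrary
    elements this is mere reordering; afterwards \<open>b\<close> cancels against
    \<open>inv b\<close>.\<close>
  have "(b \<otimes> c') \<otimes> (a \<otimes> b') = (a \<otimes> c') \<otimes> (b \<otimes> b')"
    if "b' \<in> carrier G" "c' \<in> carrier G" for b' c'
    using assms that by (simp add: m_ac)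
  from this[of "inv b" "inv c"] show ?thesis
    using assms by simp
qed

context omega_category
begin

lemma d_cells: "x \<in> carrier C \<Longrightarrow> dd C \<alpha> n x \<in> cells C n"
  by (simp add: cells_def d_closed d_d)

lemma cells_carrier: "x \<in> cells C n \<Longrightarrow> x \<in> carrier C"
  by (simp add: cells_def)

text \<open>\<open>cells\<close> is defined through sources only. Such an \<open>x\<close> is its
  own source in dimension n, so by \<open>d_d\<close> targets fix it too, there and in all higher
  dimensions.\<close>

lemma d_cells_eq:
  assumes "x \<in> cells C n" "n \<le> m"
  shows "dd C \<alpha> m x = x"
proof -
  have "dd C \<alpha> m (dd C Minus n x) = dd C Minus n x"
    using assms d_d[of x \<alpha> m Minus n] by (simp add: cells_def)
  then show ?thesis
    using assms(1) by (simp add: cells_def)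
qed

lemma cells_mono: "x \<in> cells C m \<Longrightarrow> m \<le> n \<Longrightarrow> x \<in> cells C n"
  using d_cells_eq[of x m n Minus] by (simp add: cells_def)

lemma cmp_cells:
  assumes "composable C m x y" "m < n" "x \<in> cells C n" "y \<in> cells C n"
  shows "cmp C m x y \<in> cells C n"
  using assms d_cmp_greater[of m x y n Minus] by (simp add: cells_def cmp_closed)

section \<open>The quotient groups and their generators\<close>

lemma lam_rels_subset: "lam_rels C n \<subseteq> carrier (free_Abelian_group (cells C n))"
proof
  fix c assume "c \<in> lam_rels C n"
  then obtain m x y where c: "c = frag_of (cmp C m x y) - (frag_of x + frag_of y)"
    and *: "m < n" "x \<in> cells C n" "y \<in> cells C n" "composable C m x y"
    by (auto simp: lam_rels_def)
  show "c \<in> carrier (free_Abelian_group (cells C n))"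
    using cmp_cells[OF *(4,1,2,3)] *
      keys_diff[of "frag_of (cmp C m x y)" "frag_of x + frag_of y"]
      keys_add[of "frag_of x" "frag_of y"] unfolding c by auto
qed

lemma lam_sub_normal: "lam_sub C n \<lhd> free_Abelian_group (cells C n)"
proof -
  interpret F: comm_group "free_Abelian_group (cells C n)" by (rule abelian_free_Abelian_group)
  show ?thesis
    unfolding lam_sub_def
    by (rule F.subgroup_imp_normal[OF F.generate_is_subgroup[OF lam_rels_subset]])
qed

lemma comm_group_lam_grp: "comm_group (lam_grp C n)"
proof -
  interpret F: comm_group "free_Abelian_group (cells C n)" by (rule abelian_free_Abelian_group)
  show ?thesis
    unfolding lam_grp_def
    by (rule F.abelian_FactGroup) (rule normal_imp_subgroup[OF lam_sub_normal])
qed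

lemma gen_closed: "x \<in> cells C n \<Longrightarrow> gen C n x \<in> carrier (lam_grp C n)"
  by (auto simp: gen_def lam_grp_def carrier_FactGroup)

text \<open>The two representatives differ by a generator of \<open>lam_sub C n\<close>, which the
  coset absorbs.\<close>

lemma gen_cmp:
  assumes "m < n" "x \<in> cells C n" "y \<in> cells C n" "composable C m x y"
  shows "gen C n (cmp C m x y) = gen C n x \<otimes>\<^bsub>lam_grp C n\<^esub> gen C n y"
proof -
  let ?F = "free_Abelian_group (cells C n)" and ?N = "lam_sub C n"
  let ?r = "frag_of (cmp C m x y) - (frag_of x + frag_of y)"
  interpret F: comm_group ?F by (rule abelian_free_Abelian_group)
  interpret N: normal ?N ?F by (rule lam_sub_normal)
  have r: "?r \<in> ?N"
    unfolding lam_sub_def using assms by (intro generate.incl) (auto simp: lam_rels_def)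
  have s: "frag_of x + frag_of y \<in> carrier ?F"
    using F.m_closed[of "frag_of x" "frag_of y"] assms by simp
  have "?N #>\<^bsub>?F\<^esub> frag_of (cmp C m x y) = ?N #>\<^bsub>?F\<^esub> (?r \<otimes>\<^bsub>?F\<^esub> (frag_of x + frag_of y))"
    by simp
  also have "\<dots> = ?N #>\<^bsub>?F\<^esub> ?r #>\<^bsub>?F\<^esub> (frag_of x + frag_of y)"
    using F.coset_mult_assoc[of ?N ?r "frag_of x + frag_of y"] r s N.subset
    by (simp add: subset_iff)
  also have "?N #>\<^bsub>?F\<^esub> ?r = ?N"
    using r N.rcos_const by blast
  also have "?N #>\<^bsub>?F\<^esub> (frag_of x + frag_of y) =
      (?N #>\<^bsub>?F\<^esub> frag_of x) <#>\<^bsub>?F\<^esub> (?N #>\<^bsub>?F\<^esub> frag_of y)"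
    using assms by (subst N.rcos_sum) auto
  finally show ?thesis
    by (simp add: gen_def lam_grp_def)
qed

text \<open>A cell \<open>x\<close> of dimension \<open>m < n\<close> satisfies \<open>x #\<^sub>m x = x\<close>, so its class is idempotent.\<close>

lemma gen_degenerate:
  assumes "x \<in> cells C m" "m < n"
  shows "gen C n x = \<one>\<^bsub>lam_grp C n\<^esub>"
proof -
  interpret G: comm_group "lam_grp C n" by (rule comm_group_lam_grp)
  have x: "x \<in> cells C n" "x \<in> carrier C"
    using assms cells_mono by (auto simp: cells_def)
  have "composable C m x x"
    using assms x d_cells_eq by (simp add: composable_def)
  moreover have "cmp C m x x = x"
    using cmp_unit_left[OF x(2), of m] assms d_cells_eq by simp
  ultimately have "gen C n x = gen C n x \<otimes>\<^bsub>lam_grp C n\<^esub> gen C n x"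
    using gen_cmp[of m n x x] assms x by simp
  then show ?thesis
    using gen_closed[OF x(1)] by (simp add: G.l_cancel_one)
qed

section \<open>Homomorphisms out of the groups \<open>lam_grp C n\<close>\<close>

lemma lam_lift:
  assumes "comm_group G" "\<phi> \<in> cells C n \<rightarrow> carrier G"
    and "\<And>m x y. \<lbrakk>m < n; x \<in> cells C n; y \<in> cells C n; composable C m x y\<rbrakk> \<Longrightarrow>
      \<phi> (cmp C m x y) = \<phi> x \<otimes>\<^bsub>G\<^esub> \<phi> y"
  shows lam_lift_hom: "lam_lift C n G \<phi> \<in> hom (lam_grp C n) G"
    and lam_lift_ext: "lam_lift C n G \<phi> \<in> extensional (carrier (lam_grp C n))"
    and lam_lift_gen: "x \<in> cells C n \<Longrightarrow> lam_lift C n G \<phi> (gen C n x) = \<phi> x"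
proof -
  have "\<exists>!h. h \<in> hom (lam_grp C n) G \<inter> extensional (carrier (lam_grp C n)) \<and>
     (\<forall>x \<in> cells C n. h (gen C n x) = \<phi> x)"
    using assms cmp_cells by (intro lam_lift_unique) auto
  from theI'[OF this] show "lam_lift C n G \<phi> \<in> hom (lam_grp C n) G"
    "lam_lift C n G \<phi> \<in> extensional (carrier (lam_grp C n))"
    "x \<in> cells C n \<Longrightarrow> lam_lift C n G \<phi> (gen C n x) = \<phi> x"
    by (auto simp: lam_lift_def)
qed

text \<open>Both maps, cut down to extensional functions, solve the lifting problem for the same
  values on generators, so the uniqueness in \<open>lam_lift_unique\<close> identifies them.\<close>

lemma lam_hom_eq:
  assumes G: "comm_group G" and h: "h \<in> hom (lam_grp C n) G" and k: "k \<in> hom (lam_grp C n) G"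
    and eq: "\<And>x. x \<in> cells C n \<Longrightarrow> h (gen C n x) = k (gen C n x)"
    and X: "X \<in> carrier (lam_grp C n)"
  shows "h X = k X"
proof -
  interpret L: comm_group "lam_grp C n" by (rule comm_group_lam_grp)
  let ?R = "\<lambda>h. restrict h (carrier (lam_grp C n))"
  let ?P = "\<lambda>h'. h' \<in> hom (lam_grp C n) G \<inter> extensional (carrier (lam_grp C n)) \<and>
     (\<forall>x \<in> cells C n. h' (gen C n x) = h (gen C n x))"
  have R: "?R f \<in> hom (lam_grp C n) G" if "f \<in> hom (lam_grp C n) G" for f
    using that by (auto simp: hom_def)
  have "\<exists>!h'. ?P h'"
    using G hom_in_carrier[OF h] cmp_cells gen_cmp gen_closed hom_mult[OF h]
    by (intro lam_lift_unique) auto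
  moreover have "?P (?R h)" "?P (?R k)"
    using R[OF h] R[OF k] eq gen_closed by auto
  ultimately have "?R h = ?R k"
    by blast
  from fun_cong[OF this, of X] X show ?thesis
    by simp
qed

lemma lam_hom_eq_ext:
  assumes "comm_group G" "h \<in> hom (lam_grp C n) G" "k \<in> hom (lam_grp C n) G"
    and "h \<in> extensional (carrier (lam_grp C n))" "k \<in> extensional (carrier (lam_grp C n))"
    and "\<And>x. x \<in> cells C n \<Longrightarrow> h (gen C n x) = k (gen C n x)"
  shows "h = k"
  using assms by (intro extensionalityI[OF assms(4,5)]) (rule lam_hom_eq)

section \<open>Boundary and augmentation\<close>

lemma bd_lam:
  shows bd_lam_hom: "bd (lam C) n \<in> hom (lam_grp C (Suc n)) (lam_grp C n)"
    and bd_lam_gen: "x \<in> cells C (Suc n) \<Longrightarrow> bd (lam C) n (gen C (Suc n) x) =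
      gen C n (dd C Plus n x) \<otimes>\<^bsub>lam_grp C n\<^esub> inv\<^bsub>lam_grp C n\<^esub> gen C n (dd C Minus n x)"
proof -
  interpret G: comm_group "lam_grp C n" by (rule comm_group_lam_grp)
  let ?\<phi> = "\<lambda>x. gen C n (dd C Plus n x) \<otimes>\<^bsub>lam_grp C n\<^esub> inv\<^bsub>lam_grp C n\<^esub> gen C n (dd C Minus n x)"
  have cl: "gen C n (dd C \<alpha> n x) \<in> carrier (lam_grp C n)" if "x \<in> carrier C" for x \<alpha>
    using that d_cells gen_closed by blast
  have "?\<phi> (cmp C m x y) = ?\<phi> x \<otimes>\<^bsub>lam_grp C n\<^esub> ?\<phi> y"
    if *: "m < Suc n" "x \<in> cells C (Suc n)" "y \<in> cells C (Suc n)" "composable C m x y" for m x y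
  proof -
    have xy: "x \<in> carrier C" "y \<in> carrier C"
      using * by (auto simp: cells_def)
    show ?thesis
    proof (cases "m = n")
      \<comment> \<open>The target of \<open>x\<close> is the source of \<open>y\<close>, so the two
        boundaries telescope.\<close>
      case True
      have "dd C Plus n x = dd C Minus n y"
        using * True by (simp add: composable_def)
      then show ?thesis
        using d_cmp_eq[of n x y] * True cl[OF xy(1), of Minus] cl[OF xy(2)]
          G.mult_inv_telescope[of "gen C n (dd C Plus n y)" "gen C n (dd C Minus n y)"
            "gen C n (dd C Minus n x)"]
        by simp
    next
      \<comment> \<open>Now m < n, so \<open>d\<close> in dimension n distributes over the composite
        and \<open>gen\<close> turns it into a product.\<close>
      case False
      then have m: "m < n" using * by simp
      have "composable C m (dd C \<alpha> n x) (dd C \<alpha> n y)" for \<alpha>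
        using * m xy by (simp add: composable_def d_closed d_d)
      then have "gen C n (dd C \<alpha> n (cmp C m x y)) =
          gen C n (dd C \<alpha> n x) \<otimes>\<^bsub>lam_grp C n\<^esub> gen C n (dd C \<alpha> n y)" for \<alpha>
        using gen_cmp[OF m] d_cells xy d_cmp_greater[OF *(4) m] by simp
      then show ?thesis
        using cl[OF xy(1)] cl[OF xy(2)] by (simp add: G.inv_mult G.m_ac)
    qed
  qed
  then have *: "comm_group (lam_grp C n)" "?\<phi> \<in> cells C (Suc n) \<rightarrow> carrier (lam_grp C n)"
    "\<And>m x y. \<lbrakk>m < Suc n; x \<in> cells C (Suc n); y \<in> cells C (Suc n); composable C m x y\<rbrakk> \<Longrightarrow>
      ?\<phi> (cmp C m x y) = ?\<phi> x \<otimes>\<^bsub>lam_grp C n\<^esub> ?\<phi> y"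
    using cl G.comm_group_axioms by (auto simp: cells_def)
  show "bd (lam C) n \<in> hom (lam_grp C (Suc n)) (lam_grp C n)"
    using lam_lift_hom[of "lam_grp C n" ?\<phi> "Suc n", OF *] by (simp add: lam_def)
  show "x \<in> cells C (Suc n) \<Longrightarrow> bd (lam C) n (gen C (Suc n) x) = ?\<phi> x"
    using lam_lift_gen[of "lam_grp C n" ?\<phi> "Suc n", OF *] by (simp add: lam_def)
qed

text \<open>Truncating in dimension n + 1 does not change the faces in dimension n. That the value
  is the same for both signs makes the square of the boundary trivial and gives the double-sequence
  condition for \<open>eta\<close>.\<close>

lemma bd_lam_gen_d:
  assumes "x \<in> carrier C"
  shows "bd (lam C) n (gen C (Suc n) (dd C \<alpha> (Suc n) x)) =
    gen C n (dd C Plus n x) \<otimes>\<^bsub>lam_grp C n\<^esub> inv\<^bsub>lam_grp C n\<^esub> gen C n (dd C Minus n x)"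
  using assms d_cells[of x \<alpha> "Suc n"] by (simp add: bd_lam_gen d_d)

text \<open>No m satisfies m < 0, so degree 0 has no relations and every assignment on generators
  extends.\<close>

lemma aug_lam:
  shows aug_lam_hom: "aug (lam C) \<in> hom (lam_grp C 0) integer_group"
    and aug_lam_gen: "x \<in> cells C 0 \<Longrightarrow> aug (lam C) (gen C 0 x) = 1"
  using lam_lift_hom[of integer_group "\<lambda>x. 1" 0] lam_lift_gen[of integer_group "\<lambda>x. 1" 0]
  by (auto simp: lam_def abelian_integer_group)

section \<open>Positive submonoids and the complex axioms\<close>

lemma pos_lam: "submonoid (pos (lam C) n) (lam_grp C n)"
proof -
  interpret G: comm_group "lam_grp C n" by (rule comm_group_lam_grp)
  let ?S = "{H. submonoid H (lam_grp C n) \<and> gen C n ` cells C n \<subseteq> H}"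
  \<comment> \<open>The whole group belongs to the family, so the intersection that defines the hull
    is not over an empty family and stays inside the group.\<close>
  have "carrier (lam_grp C n) \<in> ?S"
    using gen_closed by (auto intro!: submonoid.intro)
  then have "\<Inter>?S \<subseteq> carrier (lam_grp C n)"
    by (rule Inter_lower)
  then have "submonoid (\<Inter>?S) (lam_grp C n)"
    by (rule submonoid.intro) (blast intro: submonoid.m_closed submonoid.one_closed)+
  then show ?thesis
    by (simp add: lam_def hull_def)
qed

lemma gen_pos: "x \<in> cells C n \<Longrightarrow> gen C n x \<in> pos (lam C) n"
  by (auto simp: lam_def intro: hull_inc)

text \<open>The elements sent into \<open>P\<close> form a submonoid containing the generators, and
  the hull is the smallest one.\<close>

lemma pos_lam_image:
  assumes G: "comm_group G" and h: "h \<in> hom (lam_grp C n) G" and P: "submonoid P G"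
    and gen: "\<And>x. x \<in> cells C n \<Longrightarrow> h (gen C n x) \<in> P"
  shows "h ` pos (lam C) n \<subseteq> P"
proof -
  interpret L: comm_group "lam_grp C n" by (rule comm_group_lam_grp)
  interpret G: comm_group G by (rule G)
  interpret P: submonoid P G by (rule P)
  interpret h: group_hom "lam_grp C n" G h
    using h by unfold_locales
  have "submonoid {X \<in> carrier (lam_grp C n). h X \<in> P} (lam_grp C n)"
    by (intro submonoid.intro) auto
  then have "pos (lam C) n \<subseteq> {X \<in> carrier (lam_grp C n). h X \<in> P}"
    unfolding lam_def adc.simps cplx.simps using gen gen_closed by (intro hull_minimal) auto
  then show ?thesis
    by auto
qed

lemma grp_lam: "grp (lam C) = lam_grp C"
  by (simp add: lam_def)

lemma aug_dir_cplx_lam: "aug_dir_cplx (lam C)"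
proof (intro aug_dir_cplx.intro chain_cplx.intro aug_dir_cplx_axioms.intro)
  fix n
  interpret G0: comm_group "lam_grp C n" by (rule comm_group_lam_grp)
  show "comm_group (grp (lam C) n)"
    by (simp add: grp_lam comm_group_lam_grp)
  show "bd (lam C) n \<in> hom (grp (lam C) (Suc n)) (grp (lam C) n)"
    by (simp add: grp_lam bd_lam_hom)
  show "submonoid (pos (lam C) n) (grp (lam C) n)"
    by (simp add: grp_lam pos_lam)
  interpret G1: comm_group "lam_grp C (Suc n)" by (rule comm_group_lam_grp)
  interpret b: group_hom "lam_grp C (Suc n)" "lam_grp C n" "bd (lam C) n"
    by unfold_locales (rule bd_lam_hom)
  show "bd (lam C) n (bd (lam C) (Suc n) x) = \<one>\<^bsub>grp (lam C) n\<^esub>"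
    if "x \<in> carrier (grp (lam C) (Suc (Suc n)))" for x
    unfolding grp_lam
  proof (rule lam_hom_eq[OF comm_group_lam_grp,
        where h = "\<lambda>x. bd (lam C) n (bd (lam C) (Suc n) x)" and k = "\<lambda>x. \<one>\<^bsub>lam_grp C n\<^esub>"])
    show "(\<lambda>x. bd (lam C) n (bd (lam C) (Suc n) x)) \<in> hom (lam_grp C (Suc (Suc n))) (lam_grp C n)"
      using hom_compose[OF bd_lam_hom bd_lam_hom] by (simp add: comp_def)
    show "(\<lambda>x. \<one>\<^bsub>lam_grp C n\<^esub>) \<in> hom (lam_grp C (Suc (Suc n))) (lam_grp C n)"
      by (simp add: hom_def)
    fix y assume y: "y \<in> cells C (Suc (Suc n))"
    have "gen C m (dd C \<alpha> m y) \<in> carrier (lam_grp C m)" for m \<alpha>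
      using y d_cells cells_carrier gen_closed by blast
    \<comment> \<open>Both terms of the inner boundary have the same boundary by
      \<open>bd_lam_gen_d\<close>, so they cancel.\<close>
    then show "bd (lam C) n (bd (lam C) (Suc n) (gen C (Suc (Suc n)) y)) = \<one>\<^bsub>lam_grp C n\<^esub>"
      using cells_carrier[OF y] y
      by (simp add: bd_lam_gen[of y] bd_lam_gen_d)
  qed (use that in \<open>simp add: grp_lam\<close>)
next
  show "aug (lam C) \<in> hom (grp (lam C) 0) integer_group"
    by (simp add: grp_lam aug_lam_hom)
next
  interpret G0: comm_group "lam_grp C 0" by (rule comm_group_lam_grp)
  interpret Z: comm_group integer_group by (rule abelian_integer_group)
  interpret a: group_hom "lam_grp C 0" integer_group "aug (lam C)"
    by unfold_locales (rule aug_lam_hom)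
  show "aug (lam C) (bd (lam C) 0 x) = 0" if "x \<in> carrier (grp (lam C) 1)" for x
  proof (rule lam_hom_eq[OF abelian_integer_group,
        where h = "\<lambda>x. aug (lam C) (bd (lam C) 0 x)" and k = "\<lambda>x. 0"])
    show "(\<lambda>x. aug (lam C) (bd (lam C) 0 x)) \<in> hom (lam_grp C 1) integer_group"
      using hom_compose[OF bd_lam_hom aug_lam_hom] by (simp add: comp_def)
    show "(\<lambda>x. 0) \<in> hom (lam_grp C 1) integer_group"
      by (simp add: hom_def)
    fix y assume y: "y \<in> cells C 1"
    then have "gen C 0 (dd C \<alpha> 0 y) \<in> carrier (lam_grp C 0)" "dd C \<alpha> 0 y \<in> cells C 0" for \<alpha>
      using d_cells cells_carrier gen_closed by blast+
    then show "aug (lam C) (bd (lam C) 0 (gen C 1 y)) = 0"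
      using bd_lam_gen[of y 0] y a.hom_mult a.hom_inv by (simp add: aug_lam_gen)
  qed (use that in \<open>simp add: grp_lam\<close>)
qed

end


section \<open>The omega-category of a complex\<close>

sublocale chain_cplx \<subseteq> G: comm_group "grp K n" for n
  by (rule grp_comm)

sublocale chain_cplx \<subseteq> b: group_hom "grp K (Suc n)" "grp K n" "bd K n" for n
  by unfold_locales (rule bd_hom)

context aug_dir_cplx
begin

lemma nu_carrier:
  "x \<in> carrier (nu K) \<longleftrightarrow>
    (\<forall>n \<alpha>. x n \<alpha> \<in> carrier (grp K n)) \<and>
    finite {n. \<exists>\<alpha>. x n \<alpha> \<noteq> \<one>\<^bsub>grp K n\<^esub>} \<and>
    (\<forall>n \<alpha>. x n Plus \<otimes>\<^bsub>grp K n\<^esub> inv\<^bsub>grp K n\<^esub> x n Minus = bd K n (x (Suc n) \<alpha>)) \<and>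
    (\<forall>n \<alpha>. x n \<alpha> \<in> pos K n) \<and> (\<forall>\<alpha>. aug K (x 0 \<alpha>) = 1)"
  by (auto simp: nu_def mu_def)

lemma nu_closed: "x \<in> carrier (nu K) \<Longrightarrow> x n \<alpha> \<in> carrier (grp K n)"
  by (simp add: nu_carrier)

lemma dd_nu: "dd (nu K) = mu_d K"
  by (simp add: nu_def mu_def)

lemma pos_closed:
  shows pos_one: "\<one>\<^bsub>grp K n\<^esub> \<in> pos K n"
    and pos_mult: "x \<in> pos K n \<Longrightarrow> y \<in> pos K n \<Longrightarrow> x \<otimes>\<^bsub>grp K n\<^esub> y \<in> pos K n"
  using pos_submonoid[of n] by (auto intro: submonoid.one_closed submonoid.m_closed)

lemma mu_d_closed:
  assumes x: "x \<in> carrier (nu K)"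
  shows "mu_d K \<alpha> n x \<in> carrier (nu K)"
proof -
  have fin: "finite {k. \<exists>\<beta>. mu_d K \<alpha> n x k \<beta> \<noteq> \<one>\<^bsub>grp K k\<^esub>}"
    by (rule finite_subset[of _ "{..n}"]) (auto simp: mu_d_def split: if_splits)
  \<comment> \<open>In degree n both entries become \<open>x n \<alpha>\<close>, so their quotient
    is one, as is the boundary of the trivial entry above. In degree n - 1 the condition survives
    because in \<open>x\<close> it holds for either sign of the entry above.\<close>
  have "mu_d K \<alpha> n x k Plus \<otimes>\<^bsub>grp K k\<^esub> inv\<^bsub>grp K k\<^esub> mu_d K \<alpha> n x k Minus =
      bd K k (mu_d K \<alpha> n x (Suc k) \<beta>)" for k \<beta>
    using x nu_closed[OF x] by (cases "Suc k = n") (auto simp: mu_d_def nu_carrier)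
  then show ?thesis
    using x fin pos_one by (auto simp: nu_carrier mu_d_def)
qed

lemma composable_nu:
  "composable (nu K) n x y \<longleftrightarrow> x \<in> carrier (nu K) \<and> y \<in> carrier (nu K) \<and>
    (\<forall>k<n. \<forall>\<beta>. x k \<beta> = y k \<beta>) \<and> x n Plus = y n Minus"
  by (auto simp: composable_def dd_nu mu_d_def fun_eq_iff)

text \<open>The correction term \<open>mu_d K Plus n x\<close> is the common part of
  \<open>x\<close> and \<open>y\<close> below degree n, the shared face in degree n, where it
  cancels \<open>x n Plus\<close> or \<open>y n Minus\<close>, and one above.\<close>

lemma cmp_nu:
  assumes "composable (nu K) n x y"
  shows "cmp (nu K) n x y = (\<lambda>k \<beta>. if k < n then x k \<beta>
    else if k = n then (if \<beta> = Minus then x n Minus else y n Plus)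
    else x k \<beta> \<otimes>\<^bsub>grp K k\<^esub> y k \<beta>)"
proof -
  have x: "x \<in> carrier (nu K)" and y: "y \<in> carrier (nu K)"
    and eq: "\<And>k \<beta>. k < n \<Longrightarrow> y k \<beta> = x k \<beta>" "y n Minus = x n Plus"
    using assms by (auto simp: composable_nu)
  have "cmp (nu K) n x y k \<beta> =
      x k \<beta> \<otimes>\<^bsub>grp K k\<^esub> inv\<^bsub>grp K k\<^esub> mu_d K Plus n x k \<beta> \<otimes>\<^bsub>grp K k\<^esub> y k \<beta>" for k \<beta>
    by (simp add: nu_def mu_def)
  moreover have "a \<otimes>\<^bsub>grp K k\<^esub> (inv\<^bsub>grp K k\<^esub> a \<otimes>\<^bsub>grp K k\<^esub> b) = b"
    if "a \<in> carrier (grp K k)" "b \<in> carrier (grp K k)" for a b k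
    using that by (simp flip: G.m_assoc)
  ultimately show ?thesis
    using nu_closed[OF x] nu_closed[OF y] eq
    by (intro ext) (auto simp: mu_d_def G.m_assoc not_Minus_iff)
qed

lemma cmp_nu_closed:
  assumes c: "composable (nu K) n x y"
  shows "cmp (nu K) n x y \<in> carrier (nu K)"
proof -
  let ?z = "cmp (nu K) n x y"
  have x: "x \<in> carrier (nu K)" and y: "y \<in> carrier (nu K)"
    and eq: "\<And>k \<beta>. k < n \<Longrightarrow> x k \<beta> = y k \<beta>" "x n Plus = y n Minus"
    using c by (auto simp: composable_nu)
  note cl = nu_closed[OF x] nu_closed[OF y]
  have bx: "bd K k (x (Suc k) \<beta>) = x k Plus \<otimes>\<^bsub>grp K k\<^esub> inv\<^bsub>grp K k\<^esub> x k Minus"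
    and bY: "bd K k (y (Suc k) \<beta>) = y k Plus \<otimes>\<^bsub>grp K k\<^esub> inv\<^bsub>grp K k\<^esub> y k Minus" for k \<beta>
    using x y by (auto simp: nu_carrier)
  have "finite ({k. \<exists>\<beta>. x k \<beta> \<noteq> \<one>\<^bsub>grp K k\<^esub>} \<union> {k. \<exists>\<beta>. y k \<beta> \<noteq> \<one>\<^bsub>grp K k\<^esub>})"
    using x y by (simp add: nu_carrier)
  then have fin: "finite {k. \<exists>\<beta>. ?z k \<beta> \<noteq> \<one>\<^bsub>grp K k\<^esub>}"
    by (rule rev_finite_subset) (use cl in \<open>auto simp: cmp_nu[OF c] split: if_splits\<close>)
  have "?z k Plus \<otimes>\<^bsub>grp K k\<^esub> inv\<^bsub>grp K k\<^esub> ?z k Minus = bd K k (?z (Suc k) \<beta>)" for k \<beta>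
  proof -
    \<comment> \<open>The formula for the composite changes at degree n. If
      \<open>Suc k = n\<close>, the entry above comes from \<open>x\<close> or from \<open>y\<close>
      according to its sign, but both give the same boundary because \<open>x\<close> and
      \<open>y\<close> agree in degree k.\<close>
    consider "Suc k < n" | "Suc k = n" | "k = n" | "n < k" by linarith
    then show ?thesis
    proof cases
      \<comment> \<open>The entry above is already a product, while degree n keeps only the two
        outer faces: the shared face telescopes away.\<close>
      case 3
      then show ?thesis
        using cl G.mult_inv_telescope[of "y n Plus" n "y n Minus" "x n Minus"]
        by (simp add: cmp_nu[OF c] bx bY eq)
    next
      case 4
      then show ?thesis
        using cl by (simp add: cmp_nu[OF c] bx bY G.inv_mult G.m_ac)
    qed (use eq in \<open>auto simp: cmp_nu[OF c] bx bY\<close>)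
  qed
  moreover have "?z k \<beta> \<in> carrier (grp K k)" "?z k \<beta> \<in> pos K k" "aug K (?z 0 \<beta>) = 1" for k \<beta>
    using x y pos_mult by (auto simp: cmp_nu[OF c] nu_carrier)
  ultimately show ?thesis
    using fin by (simp add: nu_carrier)
qed

lemma omega_category_nu: "omega_category (nu K)"
proof (rule omega_category.intro)
  fix x y z n
  assume "(composable (nu K) n x y \<and> composable (nu K) n (cmp (nu K) n x y) z) \<or>
       (composable (nu K) n y z \<and> composable (nu K) n x (cmp (nu K) n y z))"
  \<comment> \<open>Either alternative gives both, because a composite agrees with each factor below
    degree n and keeps their outer entries in degree n.\<close>
  then have xy: "composable (nu K) n x y" and yz: "composable (nu K) n y z"
    by (auto simp: composable_nu cmp_nu)
  have c: "composable (nu K) n (cmp (nu K) n x y) z" "composable (nu K) n x (cmp (nu K) n y z)"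
    using xy yz cmp_nu_closed[OF xy] cmp_nu_closed[OF yz]
    by (auto simp: composable_nu cmp_nu[OF xy] cmp_nu[OF yz])
  show "cmp (nu K) n (cmp (nu K) n x y) z = cmp (nu K) n x (cmp (nu K) n y z)"
    unfolding cmp_nu[OF c(1)] cmp_nu[OF c(2)] unfolding cmp_nu[OF xy] cmp_nu[OF yz]
    using xy yz nu_closed by (intro ext) (auto simp: composable_nu G.m_assoc)
next
  fix m n x y x' y'
  assume mn: "m < n" and xy: "composable (nu K) n x y" "composable (nu K) n x' y'"
    and c: "composable (nu K) m (cmp (nu K) n x y) (cmp (nu K) n x' y')"
  \<comment> \<open>In degrees up to m < n a composite over n agrees with both of its
    factors.\<close>
  have xx: "composable (nu K) m x x'" "composable (nu K) m y y'"
    using mn xy c by (auto simp: composable_nu cmp_nu)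
  have d: "composable (nu K) n (cmp (nu K) m x x') (cmp (nu K) m y y')"
    using mn xy cmp_nu_closed[OF xx(1)] cmp_nu_closed[OF xx(2)]
    by (auto simp: composable_nu cmp_nu[OF xx(1)] cmp_nu[OF xx(2)])
  \<comment> \<open>Above degree n the two sides are fourfold products in different orders, equal by
    commutativity.\<close>
  show "cmp (nu K) m (cmp (nu K) n x y) (cmp (nu K) n x' y') =
      cmp (nu K) n (cmp (nu K) m x x') (cmp (nu K) m y y')"
    unfolding cmp_nu[OF c] cmp_nu[OF d]
    unfolding cmp_nu[OF xy(1)] cmp_nu[OF xy(2)] cmp_nu[OF xx(1)] cmp_nu[OF xx(2)]
    using mn xy xx nu_closed by (intro ext) (auto simp: composable_nu G.m_ac)
next
  fix x \<alpha> \<beta> m n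
  assume x: "x \<in> carrier (nu K)"
  show "dd (nu K) \<alpha> n x \<in> carrier (nu K)"
    using x by (simp add: dd_nu mu_d_closed)
  show "dd (nu K) \<beta> m (dd (nu K) \<alpha> n x) =
      (if m < n then dd (nu K) \<beta> m x else dd (nu K) \<alpha> n x)"
    by (auto simp: dd_nu mu_d_def fun_eq_iff)
  \<comment> \<open>The support lies strictly below N, so from degree N on the entries of both signs
    are one and truncation at N changes nothing.\<close>
  obtain N where "\<And>k. k \<in> {n. \<exists>\<alpha>. x n \<alpha> \<noteq> \<one>\<^bsub>grp K n\<^esub>} \<Longrightarrow> k < N"
    using x finite_nat_set_iff_bounded by (auto simp: nu_carrier)
  then have "x k \<alpha> = \<one>\<^bsub>grp K k\<^esub>" if "N \<le> k" for k \<alpha>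
    using that by (metis (mono_tags, lifting) leD mem_Collect_eq)
  then show "\<exists>n. dd (nu K) Minus n x = x \<and> dd (nu K) Plus n x = x"
    by (intro exI[of _ N]) (auto simp: dd_nu mu_d_def fun_eq_iff)
  have "composable (nu K) n (mu_d K Minus n x) x" "composable (nu K) n x (mu_d K Plus n x)"
    using x mu_d_closed[OF x, of Minus n] mu_d_closed[OF x, of Plus n]
    by (auto simp: composable_nu) (auto simp: mu_d_def)
  from this[THEN cmp_nu] show "cmp (nu K) n (dd (nu K) Minus n x) x = x"
    "cmp (nu K) n x (dd (nu K) Plus n x) = x"
    using nu_closed[OF x] by (auto simp: dd_nu mu_d_def fun_eq_iff not_Minus_iff)
next
  fix n x y m \<alpha>
  assume c: "composable (nu K) n x y"
  show "cmp (nu K) n x y \<in> carrier (nu K)"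
    using c by (rule cmp_nu_closed)
  show "dd (nu K) Minus n (cmp (nu K) n x y) = dd (nu K) Minus n x \<and>
      dd (nu K) Plus n (cmp (nu K) n x y) = dd (nu K) Plus n y"
    using c by (auto simp: cmp_nu composable_nu dd_nu mu_d_def fun_eq_iff)
  show "dd (nu K) \<alpha> m (cmp (nu K) n x y) = dd (nu K) \<alpha> m x \<and> dd (nu K) \<alpha> m x = dd (nu K) \<alpha> m y \<and>
      dd (nu K) \<alpha> m y = cmp (nu K) n (dd (nu K) \<alpha> m x) (dd (nu K) \<alpha> m y)" if "m < n"
  proof -
    have d: "composable (nu K) n (mu_d K \<alpha> m x) (mu_d K \<alpha> m y)"
      using c that mu_d_closed[of x \<alpha> m] mu_d_closed[of y \<alpha> m]
      by (auto simp: composable_nu) (auto simp: mu_d_def)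
    show ?thesis
      unfolding dd_nu cmp_nu[OF c] cmp_nu[OF d]
      using c that by (auto simp: composable_nu mu_d_def fun_eq_iff)
  qed
  show "dd (nu K) \<alpha> m (cmp (nu K) n x y) = cmp (nu K) n (dd (nu K) \<alpha> m x) (dd (nu K) \<alpha> m y)"
    if "n < m"
  proof -
    have d: "composable (nu K) n (mu_d K \<alpha> m x) (mu_d K \<alpha> m y)"
      using c that mu_d_closed[of x \<alpha> m] mu_d_closed[of y \<alpha> m]
      by (auto simp: composable_nu) (auto simp: mu_d_def)
    show ?thesis
      unfolding dd_nu cmp_nu[OF c] cmp_nu[OF d]
      using c that by (auto simp: composable_nu mu_d_def fun_eq_iff)
  qed
qed

end

section \<open>Functoriality\<close>

lemma omega_hom_cmp:
  "f \<in> omega_hom C D \<Longrightarrow> composable C n x y \<Longrightarrow> f (cmp C n x y) = cmp D n (f x) (f y)"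
  by (simp add: omega_hom_def)

lemma omega_hom_d:
  "f \<in> omega_hom C D \<Longrightarrow> x \<in> carrier C \<Longrightarrow> f (dd C \<alpha> n x) = dd D \<alpha> n (f x)"
  by (simp add: omega_hom_def)

lemma omega_hom_closed: "f \<in> omega_hom C D \<Longrightarrow> x \<in> carrier C \<Longrightarrow> f x \<in> carrier D"
  by (auto simp: omega_hom_def)

lemma omega_hom_composable:
  assumes f: "f \<in> omega_hom C D" and "composable C n x y"
  shows "composable D n (f x) (f y)"
  using assms(2) omega_hom_closed[OF f] by (auto simp: composable_def simp flip: omega_hom_d[OF f])

lemma omega_hom_cells: "f \<in> omega_hom C D \<Longrightarrow> x \<in> cells C n \<Longrightarrow> f x \<in> cells D n"
  using omega_hom_d[of f C D x Minus n] omega_hom_closed[of f C D x] by (simp add: cells_def)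

lemma adc_homD:
  assumes "f \<in> adc_hom K L"
  shows adc_hom_hom: "f n \<in> hom (grp K n) (grp L n)"
    and adc_hom_ext: "f n \<in> extensional (carrier (grp K n))"
    and adc_hom_bd: "x \<in> carrier (grp K (Suc n)) \<Longrightarrow> bd L n (f (Suc n) x) = f n (bd K n x)"
    and adc_hom_aug: "x \<in> carrier (grp K 0) \<Longrightarrow> aug L (f 0 x) = aug K x"
    and adc_hom_pos: "x \<in> pos K n \<Longrightarrow> f n x \<in> pos L n"
  using assms by (simp_all add: adc_hom_def image_subset_iff)

text \<open>Confined to one degree, with single groups \<open>G\<close> and \<open>H\<close> as
  targets, so that the conclusions supply the premises of \<open>lam_hom_eq_ext\<close> degree by
  degree.\<close>

lemma (in omega_category) adc_comp_lam:
  assumes "f n \<in> hom (lam_grp C n) G" "g n \<in> hom G H"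
  shows adc_comp_lam_hom: "adc_comp (lam C) g f n \<in> hom (lam_grp C n) H"
    and adc_comp_lam_ext: "adc_comp (lam C) g f n \<in> extensional (carrier (lam_grp C n))"
    and adc_comp_lam_gen:
      "x \<in> cells C n \<Longrightarrow> adc_comp (lam C) g f n (gen C n x) = g n (f n (gen C n x))"
proof -
  interpret G: comm_group "lam_grp C n" by (rule comm_group_lam_grp)
  show "adc_comp (lam C) g f n \<in> hom (lam_grp C n) H"
    using assms by (auto simp: adc_comp_def grp_lam hom_def compose_def Pi_iff)
qed (auto simp: adc_comp_def grp_lam compose_def gen_closed)

lemma (in omega_category) adc_id_lam:
  shows adc_id_lam_hom: "adc_id (lam C) n \<in> hom (lam_grp C n) (lam_grp C n)"
    and adc_id_lam_ext: "adc_id (lam C) n \<in> extensional (carrier (lam_grp C n))"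
    and adc_id_lam_gen: "x \<in> cells C n \<Longrightarrow> adc_id (lam C) n (gen C n x) = gen C n x"
proof -
  interpret G: comm_group "lam_grp C n" by (rule comm_group_lam_grp)
  show "adc_id (lam C) n \<in> hom (lam_grp C n) (lam_grp C n)"
    by (auto simp: adc_id_def grp_lam hom_def)
qed (auto simp: adc_id_def grp_lam gen_closed)

section \<open>The action of \<open>lam\<close> on morphisms\<close>

lemma lam_map:
  assumes C: "omega_category C" and D: "omega_category D" and f: "f \<in> omega_hom C D"
  shows lam_map_hom: "lam_map C D f n \<in> hom (lam_grp C n) (lam_grp D n)"
    and lam_map_ext: "lam_map C D f n \<in> extensional (carrier (lam_grp C n))"
    and lam_map_gen: "x \<in> cells C n \<Longrightarrow> lam_map C D f n (gen C n x) = gen D n (f x)"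
proof -
  interpret C: omega_category C by (rule C)
  interpret D: omega_category D by (rule D)
  \<comment> \<open>A morphism preserves cells, composability and composites, hence the
    relations.\<close>
  have *: "comm_group (lam_grp D n)" "(\<lambda>x. gen D n (f x)) \<in> cells C n \<rightarrow> carrier (lam_grp D n)"
    "\<And>m x y. \<lbrakk>m < n; x \<in> cells C n; y \<in> cells C n; composable C m x y\<rbrakk> \<Longrightarrow>
      gen D n (f (cmp C m x y)) = gen D n (f x) \<otimes>\<^bsub>lam_grp D n\<^esub> gen D n (f y)"
    by (simp_all add: D.comm_group_lam_grp D.gen_closed omega_hom_cells[OF f] omega_hom_cmp[OF f]
        D.gen_cmp omega_hom_composable[OF f])
  show "lam_map C D f n \<in> hom (lam_grp C n) (lam_grp D n)"
    unfolding lam_map_def by (rule C.lam_lift_hom[OF *])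
  show "lam_map C D f n \<in> extensional (carrier (lam_grp C n))"
    unfolding lam_map_def by (rule C.lam_lift_ext[OF *])
  show "x \<in> cells C n \<Longrightarrow> lam_map C D f n (gen C n x) = gen D n (f x)"
    unfolding lam_map_def by (rule C.lam_lift_gen[OF *])
qed

lemma omega_id_apply: "x \<in> carrier C \<Longrightarrow> omega_id C x = x"
  by (simp add: omega_id_def)

lemma omega_comp_apply: "x \<in> carrier C \<Longrightarrow> omega_comp C g f x = g (f x)"
  by (simp add: omega_comp_def compose_def)

lemma omega_id_hom: "omega_category C \<Longrightarrow> omega_id C \<in> omega_hom C C"
  by (auto simp: omega_hom_def omega_id_def composable_def omega_category.d_closed
      omega_category.cmp_closed)

lemma omega_comp_hom:
  assumes C: "omega_category C" and f: "f \<in> omega_hom C D" and g: "g \<in> omega_hom D E"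
  shows "omega_comp C g f \<in> omega_hom C E"
proof -
  interpret C: omega_category C by (rule C)
  have "composable C n x y \<Longrightarrow> x \<in> carrier C \<and> y \<in> carrier C" for n x y
    by (simp add: composable_def)
  then show ?thesis
    using omega_hom_d[OF f] omega_hom_d[OF g] omega_hom_closed[OF f] omega_hom_closed[OF g]
      omega_hom_composable[OF f] omega_hom_cmp[OF f] omega_hom_cmp[OF g]
    by (auto simp: omega_hom_def omega_comp_def compose_def C.d_closed C.cmp_closed)
qed

lemma lam_map_id:
  assumes "omega_category C"
  shows "lam_map C C (omega_id C) = adc_id (lam C)"
proof
  interpret C: omega_category C by (rule assms)
  note i = C.omega_category_axioms C.omega_category_axioms omega_id_hom[OF assms]
  show "lam_map C C (omega_id C) n = adc_id (lam C) n" for n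
    by (rule C.lam_hom_eq_ext[OF C.comm_group_lam_grp[of n], where n = n])
      (simp_all add: lam_map[OF i] C.adc_id_lam omega_id_apply C.cells_carrier)
qed

lemma lam_map_comp:
  assumes C: "omega_category C" and D: "omega_category D" and E: "omega_category E"
    and f: "f \<in> omega_hom C D" and g: "g \<in> omega_hom D E"
  shows "lam_map C E (omega_comp C g f) = adc_comp (lam C) (lam_map D E g) (lam_map C D f)"
proof
  interpret C: omega_category C by (rule C)
  interpret E: omega_category E by (rule E)
  note gf = C E omega_comp_hom[OF C f g]
  note comp = C.adc_comp_lam[where f = "lam_map C D f" and g = "lam_map D E g",
      OF lam_map_hom[OF C D f] lam_map_hom[OF D E g]]
  show "lam_map C E (omega_comp C g f) n = adc_comp (lam C) (lam_map D E g) (lam_map C D f) n" for n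
    by (rule C.lam_hom_eq_ext[OF E.comm_group_lam_grp[of n], where n = n])
      (simp_all add: lam_map[OF gf] comp lam_map_gen[OF C D f] lam_map_gen[OF D E g]
        omega_hom_cells[OF f] omega_comp_apply C.cells_carrier)
qed

lemma lam_map_adc_hom:
  assumes C: "omega_category C" and D: "omega_category D" and f: "f \<in> omega_hom C D"
  shows "lam_map C D f \<in> adc_hom (lam C) (lam D)"
proof -
  interpret C: omega_category C by (rule C)
  interpret D: omega_category D by (rule D)
  let ?F = "lam_map C D f"
  note F = lam_map_hom[OF C D f] lam_map_gen[OF C D f]
  have bd: "bd (lam D) n (?F (Suc n) X) = ?F n (bd (lam C) n X)"
    if "X \<in> carrier (lam_grp C (Suc n))" for n X
  proof (rule C.lam_hom_eq[OF D.comm_group_lam_grp,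
        where h = "\<lambda>X. bd (lam D) n (?F (Suc n) X)" and k = "\<lambda>X. ?F n (bd (lam C) n X)"])
    show "(\<lambda>X. bd (lam D) n (?F (Suc n) X)) \<in> hom (lam_grp C (Suc n)) (lam_grp D n)"
      using hom_compose[OF F(1) D.bd_lam_hom] by (simp add: comp_def)
    show "(\<lambda>X. ?F n (bd (lam C) n X)) \<in> hom (lam_grp C (Suc n)) (lam_grp D n)"
      using hom_compose[OF C.bd_lam_hom F(1)] by (simp add: comp_def)
    interpret F: group_hom "lam_grp C n" "lam_grp D n" "?F n"
      using F(1) C.comm_group_lam_grp D.comm_group_lam_grp
      by (auto simp: group_hom_def group_hom_axioms_def comm_group.axioms)
    fix x assume x: "x \<in> cells C (Suc n)"
    then have xC: "x \<in> carrier C" by (rule C.cells_carrier)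
    show "bd (lam D) n (?F (Suc n) (gen C (Suc n) x)) = ?F n (bd (lam C) n (gen C (Suc n) x))"
      using x C.d_cells[OF xC] omega_hom_cells[OF f x]
      by (simp add: F(2) C.bd_lam_gen D.bd_lam_gen C.gen_closed omega_hom_d[OF f xC])
  qed (rule that)
  have aug: "aug (lam D) (?F 0 X) = aug (lam C) X" if "X \<in> carrier (lam_grp C 0)" for X
  proof (rule C.lam_hom_eq[OF abelian_integer_group,
        where h = "\<lambda>X. aug (lam D) (?F 0 X)" and k = "aug (lam C)"])
    show "(\<lambda>X. aug (lam D) (?F 0 X)) \<in> hom (lam_grp C 0) integer_group"
      using hom_compose[OF F(1) D.aug_lam_hom] by (simp add: comp_def)
  qed (use that in \<open>auto simp: C.aug_lam_hom F(2) C.aug_lam_gen D.aug_lam_gen omega_hom_cells[OF f]\<close>)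
  have "?F n ` pos (lam C) n \<subseteq> pos (lam D) n" for n
    by (rule C.pos_lam_image[OF D.comm_group_lam_grp F(1) D.pos_lam])
      (simp add: F(2) D.gen_pos omega_hom_cells[OF f])
  then show ?thesis
    using bd aug F(1) lam_map_ext[OF C D f] by (simp add: adc_hom_def C.grp_lam D.grp_lam)
qed

section \<open>The action of \<open>nu\<close> on morphisms\<close>

lemma nu_map_apply: "x \<in> carrier (nu K) \<Longrightarrow> nu_map K f x = (\<lambda>n \<alpha>. f n (x n \<alpha>))"
  by (simp add: nu_map_def)

text \<open>The operations of \<open>nu\<close> select entries, insert ones and multiply entries;
  homomorphisms applied degree by degree respect all three.\<close>

lemma nu_map_omega_hom:
  assumes K: "aug_dir_cplx K" and L: "aug_dir_cplx L" and f: "f \<in> adc_hom K L"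
  shows "nu_map K f \<in> omega_hom (nu K) (nu L)"
proof -
  interpret K: aug_dir_cplx K by (rule K)
  interpret L: aug_dir_cplx L by (rule L)
  interpret f: group_hom "grp K n" "grp L n" "f n" for n
    by unfold_locales (rule adc_hom_hom[OF f])
  have cl: "nu_map K f x \<in> carrier (nu L)" if x: "x \<in> carrier (nu K)" for x
  proof -
    have "finite {n. \<exists>\<alpha>. x n \<alpha> \<noteq> \<one>\<^bsub>grp K n\<^esub>}"
      using x by (simp add: K.nu_carrier)
    \<comment> \<open>A homomorphism sends one to one, so the support cannot grow.\<close>
    moreover have "x n \<alpha> \<noteq> \<one>\<^bsub>grp K n\<^esub>" if "f n (x n \<alpha>) \<noteq> \<one>\<^bsub>grp L n\<^esub>" for n \<alpha>
      using that f.hom_one by metis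
    then have "{n. \<exists>\<alpha>. f n (x n \<alpha>) \<noteq> \<one>\<^bsub>grp L n\<^esub>} \<subseteq> {n. \<exists>\<alpha>. x n \<alpha> \<noteq> \<one>\<^bsub>grp K n\<^esub>}"
      by blast
    ultimately have fin: "finite {n. \<exists>\<alpha>. f n (x n \<alpha>) \<noteq> \<one>\<^bsub>grp L n\<^esub>}"
      by (rule rev_finite_subset)
    have "f n (x n Plus) \<otimes>\<^bsub>grp L n\<^esub> inv\<^bsub>grp L n\<^esub> f n (x n Minus) = bd L n (f (Suc n) (x (Suc n) \<alpha>))"
      for n \<alpha>
    proof -
      have "bd L n (f (Suc n) (x (Suc n) \<alpha>)) = f n (bd K n (x (Suc n) \<alpha>))"
        using K.nu_closed[OF x] by (rule adc_hom_bd[OF f])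
      also have "bd K n (x (Suc n) \<alpha>) = x n Plus \<otimes>\<^bsub>grp K n\<^esub> inv\<^bsub>grp K n\<^esub> x n Minus"
        using x by (simp add: K.nu_carrier)
      finally show ?thesis
        using K.nu_closed[OF x] by simp
    qed
    moreover have "\<forall>n \<alpha>. f n (x n \<alpha>) \<in> pos L n" "\<forall>\<alpha>. aug L (f 0 (x 0 \<alpha>)) = 1"
      using x adc_hom_pos[OF f] adc_hom_aug[OF f] by (auto simp: K.nu_carrier)
    ultimately show ?thesis
      using x fin K.nu_closed[OF x] by (simp add: nu_map_apply L.nu_carrier)
  qed
  have d: "nu_map K f (dd (nu K) \<alpha> n x) = dd (nu L) \<alpha> n (nu_map K f x)"
    if x: "x \<in> carrier (nu K)" for \<alpha> n x
    using x by (auto simp: nu_map_apply K.mu_d_closed K.dd_nu L.dd_nu)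
      (auto simp: mu_d_def fun_eq_iff)
  have "nu_map K f (cmp (nu K) n x y) = cmp (nu L) n (nu_map K f x) (nu_map K f y)"
    if c: "composable (nu K) n x y" for n x y
  proof -
    have xy: "x \<in> carrier (nu K)" "y \<in> carrier (nu K)"
      using c by (auto simp: K.composable_nu)
    have c': "composable (nu L) n (nu_map K f x) (nu_map K f y)"
      using c cl[OF xy(1)] cl[OF xy(2)] by (auto simp: K.composable_nu L.composable_nu nu_map_apply)
    show ?thesis
      unfolding nu_map_apply[OF K.cmp_nu_closed[OF c]] L.cmp_nu[OF c'] unfolding K.cmp_nu[OF c]
      using xy K.nu_closed by (auto simp: nu_map_apply fun_eq_iff)
  qed
  \<comment> \<open>Off the carrier the extensional function space demands the value
    \<open>undefined\<close>, which the restriction in \<open>nu_map\<close> supplies.\<close>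
  then show ?thesis
    using cl d by (auto simp: omega_hom_def) (simp add: nu_map_def)
qed

lemma nu_map_id:
  assumes "aug_dir_cplx K"
  shows "nu_map K (adc_id K) = omega_id (nu K)"
proof -
  interpret K: aug_dir_cplx K by (rule assms)
  show ?thesis
    by (auto simp: nu_map_def adc_id_def omega_id_def K.nu_closed intro!: restrict_ext)
qed

lemma nu_map_comp:
  assumes K: "aug_dir_cplx K" and L: "aug_dir_cplx L" and f: "f \<in> adc_hom K L"
  shows "nu_map K (adc_comp K g f) = omega_comp (nu K) (nu_map L g) (nu_map K f)"
proof -
  interpret K: aug_dir_cplx K by (rule K)
  have "nu_map K f x \<in> carrier (nu L)" if "x \<in> carrier (nu K)" for x
    using omega_hom_closed[OF nu_map_omega_hom[OF K L f] that] .
  then show ?thesis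
    unfolding omega_comp_def compose_def nu_map_def[of K "adc_comp K g f"]
    by (intro restrict_ext)
      (auto simp: nu_map_apply adc_comp_def compose_def K.nu_closed fun_eq_iff)
qed

section \<open>The unit and the counit\<close>

lemma eta_apply: "x \<in> carrier C \<Longrightarrow> eta C x = (\<lambda>n \<alpha>. gen C n (dd C \<alpha> n x))"
  by (simp add: eta_def)

lemma eta_hom:
  assumes "omega_category C"
  shows "eta C \<in> omega_hom C (nu (lam C))"
proof -
  interpret C: omega_category C by (rule assms)
  interpret L: aug_dir_cplx "lam C" by (rule C.aug_dir_cplx_lam)
  have gcl: "gen C n (dd C \<alpha> n x) \<in> carrier (lam_grp C n)" if "x \<in> carrier C" for n \<alpha> x
    using that C.d_cells C.gen_closed by blast
  have cl: "eta C x \<in> carrier (nu (lam C))" if x: "x \<in> carrier C" for x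
  proof -
    \<comment> \<open>Beyond the dimension N of \<open>x\<close>, every truncation of
      \<open>x\<close> is \<open>x\<close> itself, whose class is trivial there; this bounds the
      support.\<close>
    obtain N where N: "x \<in> cells C N"
      using C.d_stable[OF x] x by (auto simp: cells_def)
    have "gen C n (dd C \<alpha> n x) = \<one>\<^bsub>lam_grp C n\<^esub>" if "N < n" for n \<alpha>
      using C.d_cells_eq[OF N, of n] C.gen_degenerate[OF N that] that by simp
    then have "{n. \<exists>\<alpha>. gen C n (dd C \<alpha> n x) \<noteq> \<one>\<^bsub>lam_grp C n\<^esub>} \<subseteq> {..N}"
      by (auto simp: not_less[symmetric])
    then have "finite {n. \<exists>\<alpha>. gen C n (dd C \<alpha> n x) \<noteq> \<one>\<^bsub>lam_grp C n\<^esub>}"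
      by (rule finite_subset) simp
    then show ?thesis
      using x gcl[OF x] C.d_cells[OF x]
      by (simp add: L.nu_carrier C.grp_lam eta_apply C.bd_lam_gen_d C.gen_pos C.aug_lam_gen)
  qed
  \<comment> \<open>Above degree n the truncation in \<open>nu\<close> inserts one, whereas
    \<open>eta\<close> gives the class of an n-cell; \<open>gen_degenerate\<close> reconciles
    them.\<close>
  have d: "eta C (dd C \<alpha> n x) = dd (nu (lam C)) \<alpha> n (eta C x)" if x: "x \<in> carrier C" for \<alpha> n x
    using x C.gen_degenerate[OF C.d_cells[OF x]]
    by (auto simp: eta_apply C.d_closed L.dd_nu mu_d_def C.d_d C.grp_lam fun_eq_iff)
  have "eta C (cmp C n x y) = cmp (nu (lam C)) n (eta C x) (eta C y)"
    if c: "composable C n x y" for n x y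
  proof -
    have xy: "x \<in> carrier C" "y \<in> carrier C" and eq: "dd C Plus n x = dd C Minus n y"
      using c by (auto simp: composable_def)
    have c': "composable (nu (lam C)) n (eta C x) (eta C y)"
      using xy eq cl by (simp add: composable_def flip: d)
    \<comment> \<open>Above degree n a defining relation of \<open>lam_grp C k\<close> yields the
      product that \<open>cmp_nu\<close> prescribes.\<close>
    have "gen C k (dd C \<alpha> k (cmp C n x y)) =
        gen C k (dd C \<alpha> k x) \<otimes>\<^bsub>lam_grp C k\<^esub> gen C k (dd C \<alpha> k y)" if "n < k" for k \<alpha>
    proof -
      have "composable C n (dd C \<alpha> k x) (dd C \<alpha> k y)"
        using xy eq that by (simp add: composable_def C.d_closed C.d_d)
      then show ?thesis
        using C.gen_cmp[OF that] C.d_cells xy C.d_cmp_greater[OF c that] by simp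
    qed
    then show ?thesis
      unfolding L.cmp_nu[OF c'] eta_apply[OF C.cmp_closed[OF c]]
      using xy C.d_cmp_less[OF c] C.d_cmp_eq[OF c]
      by (auto simp: eta_apply fun_eq_iff C.grp_lam not_Minus_iff)
  qed
  then show ?thesis
    using cl d by (auto simp: omega_hom_def) (simp add: eta_def)
qed

lemma eta_natural:
  assumes C: "omega_category C" and D: "omega_category D" and f: "f \<in> omega_hom C D"
  shows "omega_comp C (nu_map (lam C) (lam_map C D f)) (eta C) = omega_comp C (eta D) f"
proof -
  interpret C: omega_category C by (rule C)
  show ?thesis
    unfolding omega_comp_def compose_def
    using omega_hom_closed[OF eta_hom[OF C]] omega_hom_closed[OF f] C.d_cells
    by (intro restrict_ext)
      (auto simp: nu_map_apply eta_apply lam_map_gen[OF C D f] omega_hom_d[OF f])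
qed

section \<open>The counit and the triangle identities\<close>

context aug_dir_cplx
begin

interpretation N: omega_category "nu K" by (rule omega_category_nu)

text \<open>Relations in degree n come from composites over m < n, and for these
  \<open>cmp_nu\<close> multiplies the entries of degree n.\<close>

lemma counit:
  shows counit_hom: "counit K n \<in> hom (lam_grp (nu K) n) (grp K n)"
    and counit_ext: "counit K n \<in> extensional (carrier (lam_grp (nu K) n))"
    and counit_gen: "x \<in> cells (nu K) n \<Longrightarrow> counit K n (gen (nu K) n x) = x n Minus"
proof -
  have *: "comm_group (grp K n)" "(\<lambda>x. x n Minus) \<in> cells (nu K) n \<rightarrow> carrier (grp K n)"
    "\<And>m x y. \<lbrakk>m < n; x \<in> cells (nu K) n; y \<in> cells (nu K) n; composable (nu K) m x y\<rbrakk> \<Longrightarrow>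
      cmp (nu K) m x y n Minus = x n Minus \<otimes>\<^bsub>grp K n\<^esub> y n Minus"
    by (auto simp: grp_comm cmp_nu intro: nu_closed N.cells_carrier)
  show "counit K n \<in> hom (lam_grp (nu K) n) (grp K n)"
    unfolding counit_def by (rule N.lam_lift_hom[of "grp K n" "\<lambda>x. x n Minus", OF *])
  show "counit K n \<in> extensional (carrier (lam_grp (nu K) n))"
    unfolding counit_def by (rule N.lam_lift_ext[of "grp K n" "\<lambda>x. x n Minus", OF *])
  show "x \<in> cells (nu K) n \<Longrightarrow> counit K n (gen (nu K) n x) = x n Minus"
    unfolding counit_def by (rule N.lam_lift_gen[of "grp K n" "\<lambda>x. x n Minus", OF *])
qed

lemma counit_adc_hom: "counit K \<in> adc_hom (lam (nu K)) K"
proof -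
  have bd: "bd K n (counit K (Suc n) X) = counit K n (bd (lam (nu K)) n X)"
    if "X \<in> carrier (lam_grp (nu K) (Suc n))" for n X
  proof (rule N.lam_hom_eq[OF grp_comm, where h = "\<lambda>X. bd K n (counit K (Suc n) X)"
        and k = "\<lambda>X. counit K n (bd (lam (nu K)) n X)"])
    show "(\<lambda>X. bd K n (counit K (Suc n) X)) \<in> hom (lam_grp (nu K) (Suc n)) (grp K n)"
      using hom_compose[OF counit_hom bd_hom] by (simp add: comp_def)
    show "(\<lambda>X. counit K n (bd (lam (nu K)) n X)) \<in> hom (lam_grp (nu K) (Suc n)) (grp K n)"
      using hom_compose[OF N.bd_lam_hom counit_hom] by (simp add: comp_def)
    interpret p: group_hom "lam_grp (nu K) n" "grp K n" "counit K n"
      using counit_hom N.comm_group_lam_grp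
      by (auto simp: group_hom_def group_hom_axioms_def comm_group.axioms)
    fix x assume x: "x \<in> cells (nu K) (Suc n)"
    then have xN: "x \<in> carrier (nu K)" by (rule N.cells_carrier)
    \<comment> \<open>The other side reads the \<open>Minus\<close> entries in degree n of the two
      truncations of \<open>x\<close>. These are \<open>x n Plus\<close> and
      \<open>x n Minus\<close>, since \<open>mu_d\<close> puts the chosen entry under both
      signs.\<close>
    have "bd K n (x (Suc n) Minus) = x n Plus \<otimes>\<^bsub>grp K n\<^esub> inv\<^bsub>grp K n\<^esub> x n Minus"
      using xN by (simp add: nu_carrier)
    then show "bd K n (counit K (Suc n) (gen (nu K) (Suc n) x)) =
        counit K n (bd (lam (nu K)) n (gen (nu K) (Suc n) x))"
      using x N.d_cells[OF xN]
      by (simp add: counit_gen N.bd_lam_gen N.gen_closed) (simp add: dd_nu mu_d_def)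
  qed (rule that)
  have aug: "aug K (counit K 0 X) = aug (lam (nu K)) X" if "X \<in> carrier (lam_grp (nu K) 0)" for X
  proof (rule N.lam_hom_eq[OF abelian_integer_group,
        where h = "\<lambda>X. aug K (counit K 0 X)" and k = "aug (lam (nu K))"])
    show "(\<lambda>X. aug K (counit K 0 X)) \<in> hom (lam_grp (nu K) 0) integer_group"
      using hom_compose[OF counit_hom aug_hom] by (simp add: comp_def)
    show "aug K (counit K 0 (gen (nu K) 0 x)) = aug (lam (nu K)) (gen (nu K) 0 x)"
      if "x \<in> cells (nu K) 0" for x
      using that N.cells_carrier[OF that] by (simp add: counit_gen N.aug_lam_gen nu_carrier)
  qed (use that in \<open>simp_all add: N.aug_lam_hom\<close>)
  have "counit K n ` pos (lam (nu K)) n \<subseteq> pos K n" for n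
  proof (rule N.pos_lam_image[OF grp_comm counit_hom pos_submonoid])
    show "counit K n (gen (nu K) n x) \<in> pos K n" if "x \<in> cells (nu K) n" for x
      using that N.cells_carrier[OF that] by (simp add: counit_gen nu_carrier)
  qed
  then show ?thesis
    using bd aug counit_hom counit_ext by (simp add: adc_hom_def N.grp_lam)
qed

text \<open>The counit reads the \<open>Minus\<close> entry in degree n of the truncation with sign
  \<alpha>; \<open>mu_d\<close> has put \<open>x n \<alpha>\<close> there, so \<open>x\<close> is
  recovered.\<close>

lemma triangle_nu:
  "omega_comp (nu K) (nu_map (lam (nu K)) (counit K)) (eta (nu K)) = omega_id (nu K)"
proof -
  have "nu_map (lam (nu K)) (counit K) (eta (nu K) x) = x" if x: "x \<in> carrier (nu K)" for x
  proof -
    have "eta (nu K) x \<in> carrier (nu (lam (nu K)))"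
      by (rule omega_hom_closed[OF eta_hom[OF omega_category_nu] x])
    then show ?thesis
      using x N.d_cells[OF x] by (simp add: nu_map_apply eta_apply counit_gen) (simp add: dd_nu mu_d_def)
  qed
  then show ?thesis
    by (simp add: omega_comp_def compose_def omega_id_def cong: restrict_cong)
qed

end

lemma counit_natural:
  assumes K: "aug_dir_cplx K" and L: "aug_dir_cplx L" and f: "f \<in> adc_hom K L"
  shows "adc_comp (lam (nu K)) (counit L) (lam_map (nu K) (nu L) (nu_map K f)) =
    adc_comp (lam (nu K)) f (counit K)"
proof
  fix n
  interpret K: aug_dir_cplx K by (rule K)
  interpret L: aug_dir_cplx L by (rule L)
  interpret N: omega_category "nu K" by (rule K.omega_category_nu)
  note F = K.omega_category_nu L.omega_category_nu nu_map_omega_hom[OF K L f]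
  note left = N.adc_comp_lam[where n = n and f = "lam_map (nu K) (nu L) (nu_map K f)"
      and g = "counit L", OF lam_map_hom[OF F] L.counit_hom]
  note right = N.adc_comp_lam[where n = n and f = "counit K" and g = f,
      OF K.counit_hom adc_hom_hom[OF f]]
  have *: "counit L n (gen (nu L) n (nu_map K f x)) = f n (x n Minus)" if "x \<in> cells (nu K) n" for x
    using L.counit_gen[OF omega_hom_cells[OF F(3) that]] N.cells_carrier[OF that]
    by (simp add: nu_map_apply)
  show "adc_comp (lam (nu K)) (counit L) (lam_map (nu K) (nu L) (nu_map K f)) n =
    adc_comp (lam (nu K)) f (counit K) n"
    by (rule N.lam_hom_eq_ext[OF L.grp_comm[of n], where n = n])
      (simp_all add: * left right lam_map_gen[OF F] K.counit_gen)
qed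

lemma triangle_lam:
  assumes C: "omega_category C"
  shows "adc_comp (lam C) (counit (lam C)) (lam_map C (nu (lam C)) (eta C)) = adc_id (lam C)"
proof
  fix n
  interpret C: omega_category C by (rule C)
  interpret L: aug_dir_cplx "lam C" by (rule C.aug_dir_cplx_lam)
  note F = C L.omega_category_nu eta_hom[OF C]
  note left = C.adc_comp_lam[where n = n and f = "lam_map C (nu (lam C)) (eta C)"
      and g = "counit (lam C)", OF lam_map_hom[OF F] L.counit_hom, unfolded C.grp_lam]
  \<comment> \<open>The entry read off is the class of the source of \<open>x\<close> in dimension
    n, and that source is \<open>x\<close> because \<open>x\<close> is an n-cell.\<close>
  have *: "counit (lam C) n (gen (nu (lam C)) n (eta C x)) = gen C n x" if "x \<in> cells C n" for x
    using L.counit_gen[OF omega_hom_cells[OF F(3) that]] C.cells_carrier[OF that] C.d_cells_eq[OF that]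
    by (simp add: eta_apply)
  show "adc_comp (lam C) (counit (lam C)) (lam_map C (nu (lam C)) (eta C)) n = adc_id (lam C) n"
    by (rule C.lam_hom_eq_ext[OF C.comm_group_lam_grp[of n], where n = n])
      (simp_all add: * left C.adc_id_lam lam_map_gen[OF F])
qed

text \<open>The adjunction takes the form of unit, counit and triangle identities. Each object has
  its own type variable, so functoriality and naturality also cover morphisms between objects over
  different types.\<close>

theorem theorem2p11:
  shows
    \<comment> \<open>lambda is a functor\<close>
    "(\<forall>C :: 'a omega_cat. omega_category C \<longrightarrow>
        aug_dir_cplx (lam C) \<and> lam_map C C (omega_id C) = adc_id (lam C)) \<and>
     (\<forall>(C :: 'a omega_cat) (D :: 'b omega_cat) f.
        omega_category C \<and> omega_category D \<and> f \<in> omega_hom C D \<longrightarrow>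
        lam_map C D f \<in> adc_hom (lam C) (lam D)) \<and>
     (\<forall>(C :: 'a omega_cat) (D :: 'b omega_cat) (E :: 'c omega_cat) f g.
        omega_category C \<and> omega_category D \<and> omega_category E \<and>
        f \<in> omega_hom C D \<and> g \<in> omega_hom D E \<longrightarrow>
        lam_map C E (omega_comp C g f) = adc_comp (lam C) (lam_map D E g) (lam_map C D f)) \<and>
     \<comment> \<open>nu is a functor\<close>
     (\<forall>K :: 'p adc. aug_dir_cplx K \<longrightarrow>
        omega_category (nu K) \<and> nu_map K (adc_id K) = omega_id (nu K)) \<and>
     (\<forall>(K :: 'p adc) (L :: 'q adc) f.
        aug_dir_cplx K \<and> aug_dir_cplx L \<and> f \<in> adc_hom K L \<longrightarrow>
        nu_map K f \<in> omega_hom (nu K) (nu L)) \<and>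
     (\<forall>(K :: 'p adc) (L :: 'q adc) (M :: 'r adc) f g.
        aug_dir_cplx K \<and> aug_dir_cplx L \<and> aug_dir_cplx M \<and>
        f \<in> adc_hom K L \<and> g \<in> adc_hom L M \<longrightarrow>
        nu_map K (adc_comp K g f) = omega_comp (nu K) (nu_map L g) (nu_map K f)) \<and>
     \<comment> \<open>eta is a natural transformation from the identity to nu lambda\<close>
     (\<forall>C :: 'a omega_cat. omega_category C \<longrightarrow> eta C \<in> omega_hom C (nu (lam C))) \<and>
     (\<forall>(C :: 'a omega_cat) (D :: 'b omega_cat) f.
        omega_category C \<and> omega_category D \<and> f \<in> omega_hom C D \<longrightarrow>
        omega_comp C (nu_map (lam C) (lam_map C D f)) (eta C) = omega_comp C (eta D) f) \<and>
     \<comment> \<open>pi is a natural transformation from lambda nu to the identity\<close>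
     (\<forall>K :: 'p adc. aug_dir_cplx K \<longrightarrow> counit K \<in> adc_hom (lam (nu K)) K) \<and>
     (\<forall>(K :: 'p adc) (L :: 'q adc) f.
        aug_dir_cplx K \<and> aug_dir_cplx L \<and> f \<in> adc_hom K L \<longrightarrow>
        adc_comp (lam (nu K)) (counit L) (lam_map (nu K) (nu L) (nu_map K f)) =
        adc_comp (lam (nu K)) f (counit K)) \<and>
     \<comment> \<open>the triangle identities\<close>
     (\<forall>C :: 'a omega_cat. omega_category C \<longrightarrow>
        adc_comp (lam C) (counit (lam C)) (lam_map C (nu (lam C)) (eta C)) = adc_id (lam C)) \<and>
     (\<forall>K :: 'p adc. aug_dir_cplx K \<longrightarrow>
        omega_comp (nu K) (nu_map (lam (nu K)) (counit K)) (eta (nu K)) = omega_id (nu K))"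
  by (intro conjI allI impI; (elim conjE)?;
      rule omega_category.aug_dir_cplx_lam lam_map_id lam_map_adc_hom lam_map_comp
        aug_dir_cplx.omega_category_nu nu_map_id nu_map_omega_hom nu_map_comp
        eta_hom eta_natural aug_dir_cplx.counit_adc_hom counit_natural triangle_lam
        aug_dir_cplx.triangle_nu; assumption)

end
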